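(* Let $\beta\in\mathbb{R}$ and let $\mathbf{Q}=\mathbf{Q}_n$ be a sequence of coupling matrices with $\|\mathbf{Q}\|_{\infty\to\infty}\le C_u'$ for some constant $C_u'>0$. Let $\mathcal{C}_n$ be a class of subsets of $[n]$ of size $s$ with $|\mathcal{C}_n|\to\infty$ and $\log|\mathcal{C}_n|\le C_u\log n$ for some constant $C_u>0$. Consider testing $H_0:\boldsymbol{\mu}=\mathbf{0}$ against $H_1:\boldsymbol{\mu}\in\Xi(\mathcal{C}_n,s,A)$ based on $\mathbf{X}\sim\mathbb{P}_{\beta,\mathbf{Q},\boldsymbol{\mu}}$. Fix $\delta\in(0,1)$, put $m_i=\sum_{j=1}^n\mathbf{Q}_{ij}X_j$, and $$L_n:=\sup_{S\in\mathcal{C}_n}\Big|\frac{1}{\sqrt{|S|}}\sum_{i\in S}\big(X_i-\tanh(\beta m_i)\big)\Big| .$$ Then there exists a constant $C'>0$ such that if $\tanh(A)\ge C'\sqrt{\frac{\log n}{s}}$, then the test which rejects $H_0$ when $$L_n>2\big(1+|\beta|\,\|\mathbf{Q}\|_{\infty\to\infty}\big)\sqrt{2(1+\delta)\log|\mathcal{C}_n|}$$ is asymptotically powerful.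
   Context: Ising model: for a symmetric real $n\times n$ matrix $\mathbf{Q}$ with zero diagonal, $\beta\in\mathbb{R}$ and $\boldsymbol{\mu}\in\mathbb{R}^n$, $\mathbb{P}_{\beta,\mathbf{Q},\boldsymbol{\mu}}$ is the law on $\{\pm1\}^n$ with $\mathbb{P}_{\beta,\mathbf{Q},\boldsymbol{\mu}}(\mathbf{X}=\mathbf{x})=\frac{1}{Z_n(\beta,\mathbf{Q},\boldsymbol{\mu})}\exp\big(\frac{\beta}{2}\mathbf{x}^\top\mathbf{Q}\mathbf{x}+\boldsymbol{\mu}^\top\mathbf{x}\big)$, where $Z_n(\beta,\mathbf{Q},\boldsymbol{\mu})$ is the normalizing constant. $\|\mathbf{Q}\|_{\infty\to\infty}=\max_i\sum_j|\mathbf{Q}_{ij}|$. Testing problem: $s=s_n\in[n]=\{1,\dots,n\}$ with $s\le n^{1-\upsilon}$ for some fixed $\upsilon>0$; $A=A_n>0$; every set in $\mathcal{C}_n$ has size $s$; $\Xi(\mathcal{C}_n,s,A)=\{\boldsymbol{\mu}\in\mathbb{R}_+^n:\ \mathrm{supp}(\boldsymbol{\mu})\in\mathcal{C}_n,\ \min_{i\in\mathrm{supp}(\boldsymbol{\mu})}\mu_i\ge A\}$, with $\mathrm{supp}(\boldsymbol{\mu})=\{i:\mu_i\neq0\}$. A test is a function $T:\{\pm1\}^n\to\{0,1\}$ ($1$ means reject $H_0$), with $\mathrm{Risk}(T)=\mathbb{P}_{\beta,\mathbf{Q},\mathbf{0}}(T(\mathbf{X})=1)+\sup_{\boldsymbol{\mu}\in\Xi(\mathcal{C}_n,s,A)}\mathbb{P}_{\beta,\mathbf{Q},\boldsymbol{\mu}}(T(\mathbf{X})=0)$.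 A sequence of tests $T_n$ is asymptotically powerful if $\limsup_{n\to\infty}\mathrm{Risk}(T_n)=0$. The constant $C'$ does not depend on $n,s,A$; it may depend on $\beta,\delta,C_u,C_u'$. *)

theory Defs
  imports "HOL-Probability.Probability"
begin

text \<open>
  The dimension \<open>n\<close> varies along the sequences considered, so vectors and matrices are
  functions on \<open>nat\<close> of which only the entries with indices in \<open>{1..n}\<close> matter.
\<close>

definition coupling_matrix :: "nat \<Rightarrow> (nat \<Rightarrow> nat \<Rightarrow> real) \<Rightarrow> bool" where
  "coupling_matrix n Q \<longleftrightarrow>
     (\<forall>i\<in>{1..n}. \<forall>j\<in>{1..n}. Q i j = Q j i) \<and> (\<forall>i\<in>{1..n}. Q i i = 0)"

definition norm_inf_inf :: "nat \<Rightarrow> (nat \<Rightarrow> nat \<Rightarrow> real) \<Rightarrow> real" where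
  "norm_inf_inf n Q = (MAX i\<in>{1..n}. \<Sum>j=1..n. \<bar>Q i j\<bar>)"

definition spins :: "nat \<Rightarrow> (nat \<Rightarrow> real) set" where
  "spins n = {1..n} \<rightarrow>\<^sub>E {-1, 1}"

definition ising_weight ::
  "nat \<Rightarrow> real \<Rightarrow> (nat \<Rightarrow> nat \<Rightarrow> real) \<Rightarrow> (nat \<Rightarrow> real) \<Rightarrow> (nat \<Rightarrow> real) \<Rightarrow> real" where
  "ising_weight n \<beta> Q \<mu> x =
     exp (\<beta> / 2 * (\<Sum>i=1..n. \<Sum>j=1..n. x i * Q i j * x j) + (\<Sum>i=1..n. \<mu> i * x i))"

definition ising_Z ::
  "nat \<Rightarrow> real \<Rightarrow> (nat \<Rightarrow> nat \<Rightarrow> real) \<Rightarrow> (nat \<Rightarrow> real) \<Rightarrow> real" where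
  "ising_Z n \<beta> Q \<mu> = (\<Sum>x\<in>spins n. ising_weight n \<beta> Q \<mu> x)"

definition ising_pmf ::
  "nat \<Rightarrow> real \<Rightarrow> (nat \<Rightarrow> nat \<Rightarrow> real) \<Rightarrow> (nat \<Rightarrow> real) \<Rightarrow> (nat \<Rightarrow> real) pmf" where
  "ising_pmf n \<beta> Q \<mu> =
     embed_pmf (\<lambda>x. if x \<in> spins n then ising_weight n \<beta> Q \<mu> x / ising_Z n \<beta> Q \<mu> else 0)"

lemma finite_spins [simp]: "finite (spins n)"
  by (simp add: spins_def finite_PiE)

lemma spins_nonempty [simp]: "spins n \<noteq> {}"
  by (simp add: spins_def PiE_eq_empty_iff)

lemma ising_weight_pos: "0 < ising_weight n \<beta> Q \<mu> x"
  by (simp add: ising_weight_def)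

lemma ising_Z_pos: "0 < ising_Z n \<beta> Q \<mu>"
  unfolding ising_Z_def by (intro sum_pos) (auto simp: ising_weight_pos)

lemma pmf_ising:
  "pmf (ising_pmf n \<beta> Q \<mu>) x =
     (if x \<in> spins n then ising_weight n \<beta> Q \<mu> x / ising_Z n \<beta> Q \<mu> else 0)"
proof -
  let ?f = "\<lambda>x. if x \<in> spins n then ising_weight n \<beta> Q \<mu> x / ising_Z n \<beta> Q \<mu> else 0"
  have nonneg: "0 \<le> ?f x" for x
    using ising_weight_pos[of n \<beta> Q \<mu> x] ising_Z_pos[of n \<beta> Q \<mu>] by simp
  have "(\<integral>\<^sup>+x. ennreal (?f x) \<partial>count_space UNIV) = (\<Sum>x\<in>spins n. ennreal (?f x))"
    by (rule nn_integral_count_space') auto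
  also have "\<dots> = ennreal (\<Sum>x\<in>spins n. ?f x)"
    by (rule sum_ennreal) (use nonneg in blast)
  also have "(\<Sum>x\<in>spins n. ?f x) = (\<Sum>x\<in>spins n. ising_weight n \<beta> Q \<mu> x / ising_Z n \<beta> Q \<mu>)"
    by simp
  also have "\<dots> = ising_Z n \<beta> Q \<mu> / ising_Z n \<beta> Q \<mu>"
    by (simp only: sum_divide_distrib [symmetric] ising_Z_def)
  also have "\<dots> = 1"
    using ising_Z_pos[of n \<beta> Q \<mu>] by simp
  finally have total: "(\<integral>\<^sup>+x. ennreal (?f x) \<partial>count_space UNIV) = 1"
    by simp
  show ?thesis
    unfolding ising_pmf_def by (rule pmf_embed_pmf[OF nonneg total])
qed

definition supp :: "nat \<Rightarrow> (nat \<Rightarrow> real) \<Rightarrow> nat set" where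
  "supp n \<mu> = {i\<in>{1..n}. \<mu> i \<noteq> 0}"

definition alternatives :: "nat \<Rightarrow> nat set set \<Rightarrow> real \<Rightarrow> (nat \<Rightarrow> real) set" where
  "alternatives n \<C> A =
     {\<mu> \<in> {1..n} \<rightarrow>\<^sub>E {0..}. supp n \<mu> \<in> \<C> \<and> (\<forall>i\<in>supp n \<mu>. A \<le> \<mu> i)}"

text \<open>A test is a predicate on configurations; \<open>True\<close> means that the null hypothesis is rejected.\<close>

definition risk ::
  "nat \<Rightarrow> real \<Rightarrow> (nat \<Rightarrow> nat \<Rightarrow> real) \<Rightarrow> nat set set \<Rightarrow> real \<Rightarrow> ((nat \<Rightarrow> real) \<Rightarrow> bool) \<Rightarrow> real" where
  "risk n \<beta> Q \<C> A T =
     measure_pmf.prob (ising_pmf n \<beta> Q (\<lambda>_. 0)) {x. T x}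
     + (SUP \<mu>\<in>alternatives n \<C> A. measure_pmf.prob (ising_pmf n \<beta> Q \<mu>) {x. \<not> T x})"

definition asymptotically_powerful ::
  "real \<Rightarrow> (nat \<Rightarrow> nat \<Rightarrow> nat \<Rightarrow> real) \<Rightarrow> (nat \<Rightarrow> nat set set) \<Rightarrow> (nat \<Rightarrow> real)
    \<Rightarrow> (nat \<Rightarrow> (nat \<Rightarrow> real) \<Rightarrow> bool) \<Rightarrow> bool" where
  "asymptotically_powerful \<beta> Q \<C> A T \<longleftrightarrow>
     limsup (\<lambda>n. ereal (risk n \<beta> (Q n) (\<C> n) (A n) (T n))) = 0"

definition local_field :: "nat \<Rightarrow> (nat \<Rightarrow> nat \<Rightarrow> real) \<Rightarrow> (nat \<Rightarrow> real) \<Rightarrow> nat \<Rightarrow> real" where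
  "local_field n Q x i = (\<Sum>j=1..n. Q i j * x j)"

definition scan_stat ::
  "nat \<Rightarrow> real \<Rightarrow> (nat \<Rightarrow> nat \<Rightarrow> real) \<Rightarrow> nat set set \<Rightarrow> (nat \<Rightarrow> real) \<Rightarrow> real" where
  "scan_stat n \<beta> Q \<C> x =
     (SUP S\<in>\<C>. \<bar>1 / sqrt (real (card S)) * (\<Sum>i\<in>S. x i - tanh (\<beta> * local_field n Q x i))\<bar>)"

definition scan_test ::
  "nat \<Rightarrow> real \<Rightarrow> (nat \<Rightarrow> nat \<Rightarrow> real) \<Rightarrow> nat set set \<Rightarrow> real \<Rightarrow> (nat \<Rightarrow> real) \<Rightarrow> bool" where
  "scan_test n \<beta> Q \<C> \<delta> x \<longleftrightarrow>
     scan_stat n \<beta> Q \<C> x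
       > 2 * (1 + \<bar>\<beta>\<bar> * norm_inf_inf n Q) * sqrt (2 * (1 + \<delta>) * ln (real (card \<C>)))"

end

theory Submission
  imports Defs
begin

text \<open>
  For a set \<open>S\<close> let \<open>f\<close> be the sum over \<open>i \<in> S\<close> of \<open>X\<^sub>i\<close> minus its conditional mean
  \<open>tanh (\<beta> m\<^sub>i + \<mu>\<^sub>i)\<close> given the other spins. Following Chatterjee's exchangeable pairs method,
  each summand times the Gibbs weight is antisymmetric under flipping spin \<open>i\<close>, while \<open>f\<close> changes
  by at most \<open>2 K\<close> with \<open>K = 1 + \<bar>\<beta>\<bar> \<parallel>Q\<parallel>\<close>; hence \<open>f\<close> is sub-Gaussian with variance proxy
  \<open>4 K \<bar>S\<bar>\<close> for every field \<open>\<mu>\<close>. Under the null hypothesis a union bound over the class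
  suffices. Under an alternative supported on \<open>S\<close>, replacing \<open>tanh (\<beta> m\<^sub>i + \<mu>\<^sub>i)\<close> by
  \<open>tanh (\<beta> m\<^sub>i)\<close> shifts \<open>f\<close> by at least a constant times \<open>\<bar>S\<bar> tanh A\<close>, because the local
  fields are bounded, and this exceeds the threshold and the fluctuations.
\<close>

section \<open>Elementary inequalities for \<open>tanh\<close> and \<open>exp\<close>\<close>

text \<open>The function \<open>x - tanh x\<close> has derivative \<open>tanh x ^ 2\<close>, so it
  is nondecreasing.\<close>

lemma tanh_lipschitz: "\<bar>tanh a - tanh b\<bar> \<le> \<bar>a - b\<bar>" for a b :: real
proof -
  have mono: "tanh v - tanh u \<le> v - u" if "u \<le> v" for u v :: real
  proof -
    have "u - tanh u \<le> v - tanh v"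
    proof (rule DERIV_nonneg_imp_nondecreasing[OF that])
      fix x :: real
      have "((\<lambda>x. x - tanh x) has_real_derivative 1 - (1 - tanh x ^ 2) * 1) (at x)"
        by (auto intro!: derivative_eq_intros simp: cosh_real_nonzero)
      then show "\<exists>y. ((\<lambda>x. x - tanh x) has_real_derivative y) (at x) \<and> 0 \<le> y"
        by (intro exI[of _ "1 - (1 - tanh x ^ 2) * 1"]) simp
    qed
    then show ?thesis by simp
  qed
  show ?thesis
  proof (cases "a \<le> b")
    case True
    then show ?thesis using mono[OF True] by (auto simp: abs_if)
  next
    case False
    then have "b \<le> a" by simp
    then show ?thesis using mono[of b a]
      by (auto simp: abs_if)
  qed
qed

text \<open>The tangent of \<open>exp\<close> at the larger point lies below the graph, which gives
  the bound with that exponential alone. The sum on the right makes the bound symmetric, as suits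
  two configurations exchanged by a flip.\<close>

lemma abs_exp_diff_le: "\<bar>exp a - exp b\<bar> \<le> \<bar>a - b\<bar> * (exp a + exp b)" for a b :: real
proof -
  have *: "\<bar>exp u - exp v\<bar> \<le> \<bar>u - v\<bar> * (exp u + exp v)" if "u \<le> v" for u v :: real
  proof -
    have "exp v * (1 + (u - v)) \<le> exp v * exp (u - v)"
      by (intro mult_left_mono exp_ge_add_one_self) simp
    also have "\<dots> = exp u" by (simp flip: exp_add)
    finally have "exp v - exp u \<le> (v - u) * exp v" by (simp add: algebra_simps)
    also have "\<dots> \<le> (v - u) * (exp u + exp v)" using that by (intro mult_left_mono) auto
    finally show ?thesis using that by simp
  qed
  show ?thesis
    using *[of a b] *[of b a] by (cases "a \<le> b") (auto simp: abs_minus_commute add.commute)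
qed

text \<open>By the addition formula the difference equals
  \<open>(1 - tanh a ^ 2) * tanh m / (1 + tanh a * tanh m)\<close>, whose denominator is at most 2.
  This turns a field of size \<open>c\<close> into a shift of the conditional mean, uniformly over
  bounded local fields \<open>a\<close>.\<close>

lemma tanh_add_diff_ge:
  fixes a b c m :: real
  assumes "\<bar>a\<bar> \<le> b" "0 \<le> c" "c \<le> m"
  shows "(1 - tanh b ^ 2) / 2 * tanh c \<le> tanh (a + m) - tanh a"
proof -
  have abs1: "\<bar>tanh x\<bar> < 1" for x :: real
    using tanh_real_lt_1[of x] tanh_real_gt_neg1[of x] by auto
  have "\<bar>tanh a * tanh m\<bar> < 1"
    using abs1[of a] abs1[of m] unfolding abs_mult
    by (metis abs_ge_zero mult_strict_mono' mult_1)
  then have den: "0 < 1 + tanh a * tanh m" "1 + tanh a * tanh m \<le> 2" by auto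
  have "\<bar>tanh a\<bar> \<le> \<bar>tanh b\<bar>"
    using assms by (simp add: flip: tanh_real_abs)
  then have sq: "tanh a ^ 2 \<le> tanh b ^ 2" by (simp add: abs_le_square_iff)
  have sq1: "tanh b ^ 2 < 1" using abs1[of b] by (simp add: abs_square_less_1)
  have tm: "0 \<le> tanh c" "tanh c \<le> tanh m" using assms by auto
  have "tanh (a + m) - tanh a = (1 - tanh a ^ 2) * tanh m / (1 + tanh a * tanh m)"
    using den by (simp add: tanh_add field_simps power2_eq_square)
  moreover have "(1 - tanh b ^ 2) * tanh c / 2 \<le> (1 - tanh a ^ 2) * tanh m / (1 + tanh a * tanh m)"
    using sq sq1 tm den by (intro frac_le mult_mono mult_nonneg_nonneg) auto
  ultimately show ?thesis by simp
qed

text \<open>Detailed balance for one spin: in a field \<open>a\<close> the values -1 and 1 have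
  probabilities \<open>(1 - tanh a) / 2\<close> and \<open>(1 + tanh a) / 2\<close>, with ratio
  \<open>exp (- 2 * a)\<close>.\<close>

lemma one_sub_tanh_eq: "1 - tanh a = (1 + tanh a) * exp (- 2 * a)" for a :: real
proof -
  have "0 < 1 + exp (- 2 * a)" by (simp add: add_pos_pos)
  then show ?thesis by (simp add: tanh_real_altdef field_simps)
qed

section \<open>Effect of a spin flip on the Gibbs weight\<close>

definition flip :: "nat \<Rightarrow> (nat \<Rightarrow> real) \<Rightarrow> nat \<Rightarrow> real" where
  "flip k x = x(k := - x k)"

lemma flip_flip [simp]: "flip k (flip k x) = x"
  by (simp add: flip_def)

lemma flip_in_spins: "k \<in> {1..n} \<Longrightarrow> x \<in> spins n \<Longrightarrow> flip k x \<in> spins n"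
  by (auto simp: spins_def flip_def PiE_iff extensional_def)

lemma bij_betw_flip: "k \<in> {1..n} \<Longrightarrow> bij_betw (flip k) (spins n) (spins n)"
  by (rule bij_betwI[where g = "flip k"]) (auto simp: flip_in_spins)

lemma spin_cases: "x \<in> spins n \<Longrightarrow> i \<in> {1..n} \<Longrightarrow> x i = 1 \<or> x i = -1"
  by (auto simp: spins_def)

text \<open>The flip adds a vector \<open>e\<close> supported on \<open>k\<close>. The two cross
  terms agree by symmetry of \<open>Q\<close>, and the term quadratic in \<open>e\<close> vanishes
  because the diagonal is zero.\<close>

lemma quadratic_form_flip:
  assumes Q: "coupling_matrix n Q" and k: "k \<in> {1..n}"
  shows "(\<Sum>i=1..n. \<Sum>j=1..n. flip k x i * Q i j * flip k x j)
       = (\<Sum>i=1..n. \<Sum>j=1..n. x i * Q i j * x j) - 4 * x k * local_field n Q x k"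
proof -
  define e where "e i = (if i = k then - 2 * x k else 0)" for i
  have flip: "flip k x i = x i + e i" for i
    by (simp add: flip_def e_def)
  have sum_e: "(\<Sum>i=1..n. e i * g i) = - 2 * x k * g k" for g
    using k by (simp add: e_def if_distrib[of "\<lambda>z. z * _"] cong: if_cong)
  have col: "(\<Sum>i=1..n. x i * Q i k) = local_field n Q x k"
    unfolding local_field_def using Q k
    by (intro sum.cong) (auto simp: coupling_matrix_def mult.commute)
  have diag: "Q k k = 0" using Q k by (simp add: coupling_matrix_def)
  have "(\<Sum>i=1..n. \<Sum>j=1..n. flip k x i * Q i j * flip k x j)
      = (\<Sum>i=1..n. \<Sum>j=1..n. x i * Q i j * x j)
        + (\<Sum>i=1..n. e i * (\<Sum>j=1..n. Q i j * x j))
        + (\<Sum>i=1..n. x i * (\<Sum>j=1..n. e j * Q i j))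
        + (\<Sum>i=1..n. e i * (\<Sum>j=1..n. e j * Q i j))"
    by (simp add: flip algebra_simps sum.distrib sum_distrib_left)
  also have "\<dots> = (\<Sum>i=1..n. \<Sum>j=1..n. x i * Q i j * x j)
        + (- 2 * x k * local_field n Q x k) + (\<Sum>i=1..n. x i * (- 2 * x k * Q i k))
        + (- 2 * x k * (- 2 * x k * Q k k))"
    by (simp only: sum_e local_field_def)
  also have "(\<Sum>i=1..n. x i * (- 2 * x k * Q i k)) = - 2 * x k * (\<Sum>i=1..n. x i * Q i k)"
    by (simp add: sum_distrib_left algebra_simps)
  finally show ?thesis unfolding col diag by simp
qed

lemma ising_weight_flip:
  assumes Q: "coupling_matrix n Q" and k: "k \<in> {1..n}"
  shows "ising_weight n \<beta> Q \<mu> (flip k x)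
       = ising_weight n \<beta> Q \<mu> x * exp (- 2 * x k * (\<beta> * local_field n Q x k + \<mu> k))"
proof -
  have "(\<Sum>i=1..n. \<mu> i * flip k x i)
      = (\<Sum>i=1..n. \<mu> i * x i + (if i = k then - 2 * \<mu> k * x k else 0))"
    by (intro sum.cong) (auto simp: flip_def)
  also have "\<dots> = (\<Sum>i=1..n. \<mu> i * x i) - 2 * \<mu> k * x k"
    using k by (simp add: sum.distrib)
  finally have lin: "(\<Sum>i=1..n. \<mu> i * flip k x i) = (\<Sum>i=1..n. \<mu> i * x i) - 2 * \<mu> k * x k" .
  show ?thesis
    unfolding ising_weight_def quadratic_form_flip[OF assms] lin exp_add [symmetric]
    by (simp add: algebra_simps)
qed

lemma local_field_flip_self:
  assumes Q: "coupling_matrix n Q" and k: "k \<in> {1..n}"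
  shows "local_field n Q (flip k x) k = local_field n Q x k"
  unfolding local_field_def using assms
  by (intro sum.cong) (auto simp: flip_def coupling_matrix_def)

section \<open>Residuals of the spins about their conditional means\<close>

text \<open>At zero field this is the summand of \<open>scan_stat\<close>; keeping
  \<open>\<mu>\<close> general lets one concentration bound serve both hypotheses.\<close>

definition spin_residual ::
  "nat \<Rightarrow> real \<Rightarrow> (nat \<Rightarrow> nat \<Rightarrow> real) \<Rightarrow> (nat \<Rightarrow> real) \<Rightarrow> nat \<Rightarrow> (nat \<Rightarrow> real) \<Rightarrow> real" where
  "spin_residual n \<beta> Q \<mu> i x = x i - tanh (\<beta> * local_field n Q x i + \<mu> i)"

text \<open>The weights with spin \<open>k\<close> equal to 1 and -1 are in the ratio
  \<open>1 + tanh a\<close> to \<open>1 - tanh a\<close>, while the residuals are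
  \<open>1 - tanh a\<close> and \<open>-(1 + tanh a)\<close>, so the two products are
  opposite.\<close>

lemma spin_residual_flip:
  assumes Q: "coupling_matrix n Q" and k: "k \<in> {1..n}" and x: "x \<in> spins n"
  shows "spin_residual n \<beta> Q \<mu> k (flip k x) * ising_weight n \<beta> Q \<mu> (flip k x)
       = - (spin_residual n \<beta> Q \<mu> k x * ising_weight n \<beta> Q \<mu> x)"
proof -
  define a where "a = \<beta> * local_field n Q x k + \<mu> k"
  \<comment> \<open>The flipped residual is \<open>-(x k + tanh a)\<close> and the flipped weight
    carries the exponential, so this identity is the antisymmetry.\<close>
  have key: "x k - tanh a = (x k + tanh a) * exp (- 2 * x k * a)"
    using spin_cases[OF x k]
  proof
    assume "x k = 1"
    then show ?thesis using one_sub_tanh_eq[of a] by (simp add: add.commute)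
  next
    assume "x k = - 1"
    moreover have "1 + tanh a = (1 - tanh a) * exp (2 * a)"
      using one_sub_tanh_eq[of "- a"] by simp
    ultimately show ?thesis by (simp add: algebra_simps)
  qed
  show ?thesis
    unfolding spin_residual_def ising_weight_flip[OF Q k] local_field_flip_self[OF Q k]
      a_def[symmetric] key
    by (simp add: flip_def algebra_simps)
qed

lemma abs_spin_residual_le:
  assumes "x \<in> spins n" "i \<in> {1..n}"
  shows "\<bar>spin_residual n \<beta> Q \<mu> i x\<bar> \<le> 2"
  using spin_cases[OF assms] tanh_real_lt_1[of "\<beta> * local_field n Q x i + \<mu> i"]
    tanh_real_gt_neg1[of "\<beta> * local_field n Q x i + \<mu> i"]
  by (auto simp: spin_residual_def)

lemma row_sum_le_norm_inf_inf:
  assumes "i \<in> {1..n}"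
  shows "(\<Sum>j=1..n. \<bar>Q i j\<bar>) \<le> norm_inf_inf n Q"
  unfolding norm_inf_inf_def using assms by (intro Max_ge) auto

lemma norm_inf_inf_nonneg: "1 \<le> n \<Longrightarrow> 0 \<le> norm_inf_inf n Q"
  by (rule order_trans[OF _ row_sum_le_norm_inf_inf[of 1 n Q]]) (auto intro: sum_nonneg)

lemma abs_local_field_le:
  assumes "x \<in> spins n" "i \<in> {1..n}"
  shows "\<bar>local_field n Q x i\<bar> \<le> norm_inf_inf n Q"
proof -
  have "\<bar>local_field n Q x i\<bar> \<le> (\<Sum>j=1..n. \<bar>Q i j * x j\<bar>)"
    unfolding local_field_def by (rule sum_abs)
  also have "\<dots> = (\<Sum>j=1..n. \<bar>Q i j\<bar>)"
    using spin_cases[OF assms(1)] by (intro sum.cong) (force simp: abs_mult)+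
  finally show ?thesis using row_sum_le_norm_inf_inf[OF assms(2)] by (rule order_trans)
qed

text \<open>The flip moves \<open>x k\<close> by 2 and each local field by
  \<open>2 * \<bar>Q i k\<bar>\<close>, which \<open>tanh\<close> does not amplify. Symmetry turns
  the resulting column sum into a row sum, so the bound does not grow with \<open>S\<close>.\<close>

lemma residual_sum_flip_diff:
  assumes Q: "coupling_matrix n Q" and k: "k \<in> {1..n}" and x: "x \<in> spins n"
    and S: "S \<subseteq> {1..n}"
  shows "\<bar>(\<Sum>i\<in>S. spin_residual n \<beta> Q \<mu> i x) - (\<Sum>i\<in>S. spin_residual n \<beta> Q \<mu> i (flip k x))\<bar>
       \<le> 2 * (1 + \<bar>\<beta>\<bar> * norm_inf_inf n Q)"
proof -
  have fin: "finite S" using S finite_subset by blast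
  have xk: "\<bar>x k\<bar> = 1" using spin_cases[OF x k] by auto
  have lf: "local_field n Q x i - local_field n Q (flip k x) i = Q i k * (2 * x k)" for i
  proof -
    have "local_field n Q x i - local_field n Q (flip k x) i
        = (\<Sum>j=1..n. if j = k then Q i k * (2 * x k) else 0)"
      unfolding local_field_def sum_subtractf [symmetric]
      by (intro sum.cong) (auto simp: flip_def)
    then show ?thesis using k by simp
  qed
  have term_le: "\<bar>spin_residual n \<beta> Q \<mu> i x - spin_residual n \<beta> Q \<mu> i (flip k x)\<bar>
      \<le> (if i = k then 2 else 0) + 2 * \<bar>\<beta>\<bar> * \<bar>Q k i\<bar>" if i: "i \<in> {1..n}" for i
  proof -
    let ?u = "\<beta> * local_field n Q x i + \<mu> i"
    let ?v = "\<beta> * local_field n Q (flip k x) i + \<mu> i"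
    have "?u - ?v = \<beta> * (local_field n Q x i - local_field n Q (flip k x) i)"
      by (simp add: algebra_simps)
    then have "?u - ?v = \<beta> * (Q i k * (2 * x k))"
      by (simp only: lf)
    then have "\<bar>?u - ?v\<bar> = 2 * \<bar>\<beta>\<bar> * \<bar>Q k i\<bar>"
      using Q i k xk by (simp add: abs_mult coupling_matrix_def)
    moreover have "\<bar>x i - flip k x i\<bar> = (if i = k then 2 else 0)"
      using xk by (auto simp: flip_def)
    ultimately show ?thesis
      using tanh_lipschitz[of ?u ?v] unfolding spin_residual_def by linarith
  qed
  have "\<bar>(\<Sum>i\<in>S. spin_residual n \<beta> Q \<mu> i x) - (\<Sum>i\<in>S. spin_residual n \<beta> Q \<mu> i (flip k x))\<bar>
      \<le> (\<Sum>i\<in>S. \<bar>spin_residual n \<beta> Q \<mu> i x - spin_residual n \<beta> Q \<mu> i (flip k x)\<bar>)"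
    unfolding sum_subtractf [symmetric] by (rule sum_abs)
  also have "\<dots> \<le> (\<Sum>i\<in>S. (if i = k then 2 else 0) + 2 * \<bar>\<beta>\<bar> * \<bar>Q k i\<bar>)"
    using S by (intro sum_mono term_le) auto
  also have "\<dots> \<le> (\<Sum>i=1..n. (if i = k then 2 else 0) + 2 * \<bar>\<beta>\<bar> * \<bar>Q k i\<bar>)"
    using S by (intro sum_mono2) auto
  also have "\<dots> = 2 + 2 * \<bar>\<beta>\<bar> * (\<Sum>i=1..n. \<bar>Q k i\<bar>)"
    using k by (simp add: sum.distrib sum_distrib_left)
  also have "\<dots> \<le> 2 + 2 * \<bar>\<beta>\<bar> * norm_inf_inf n Q"
    using row_sum_le_norm_inf_inf[OF k] by (intro add_left_mono mult_left_mono) auto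
  finally show ?thesis by simp
qed

section \<open>Moment generating function of the residual sum\<close>

text \<open>The antisymmetry under the spin flip turns the mean of \<open>f exp (\<theta> f)\<close> into one of a difference
  of exponentials, which bounds the logarithmic derivative of the moment generating function.\<close>

lemma residual_sum_mgf_deriv_le:
  fixes \<theta> \<beta> :: real and \<mu> :: "nat \<Rightarrow> real"
  assumes Q: "coupling_matrix n Q" and S: "S \<subseteq> {1..n}"
  defines "f \<equiv> \<lambda>x. \<Sum>i\<in>S. spin_residual n \<beta> Q \<mu> i x"
    and "w \<equiv> ising_weight n \<beta> Q \<mu>"
    and "K \<equiv> 1 + \<bar>\<beta>\<bar> * norm_inf_inf n Q"
  shows "\<bar>\<Sum>x\<in>spins n. w x * (f x * exp (\<theta> * f x))\<bar>
       \<le> 4 * K * real (card S) * \<bar>\<theta>\<bar> * (\<Sum>x\<in>spins n. w x * exp (\<theta> * f x))"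
proof -
  define r where "r i x = spin_residual n \<beta> Q \<mu> i x" for i x
  define M where "M = (\<Sum>x\<in>spins n. w x * exp (\<theta> * f x))"
  have wpos: "0 < w x" for x unfolding w_def by (rule ising_weight_pos)
  have single: "\<bar>\<Sum>x\<in>spins n. r k x * w x * exp (\<theta> * f x)\<bar> \<le> 4 * K * \<bar>\<theta>\<bar> * M" if "k \<in> S" for k
  proof -
    from that S have k: "k \<in> {1..n}" by auto
    have K: "0 \<le> K" using norm_inf_inf_nonneg[of n Q] k by (simp add: K_def)
    have reindex: "(\<Sum>x\<in>spins n. g (flip k x)) = (\<Sum>x\<in>spins n. g x)" for g :: "(nat \<Rightarrow> real) \<Rightarrow> real"
      by (rule sum.reindex_bij_betw[OF bij_betw_flip[OF k]])
    have anti: "r k (flip k x) * w (flip k x) = - (r k x * w x)" if "x \<in> spins n" for x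
      unfolding r_def w_def by (rule spin_residual_flip[OF Q k that])
    \<comment> \<open>Reindexing by the flip changes only the sign and the exponential; averaging
      both forms leaves half of a sum with a difference of exponentials.\<close>
    have swap: "(\<Sum>x\<in>spins n. r k x * w x * exp (\<theta> * f x))
        = - (\<Sum>x\<in>spins n. r k x * w x * exp (\<theta> * f (flip k x)))"
      unfolding reindex[of "\<lambda>x. r k x * w x * exp (\<theta> * f x)", symmetric]
      by (simp add: anti sum_negf)
    have abs_anti: "\<bar>r k (flip k x)\<bar> * w (flip k x) = \<bar>r k x\<bar> * w x" if "x \<in> spins n" for x
      using arg_cong[OF anti[OF that], of abs] wpos by (simp add: abs_mult abs_of_pos)
    \<comment> \<open>The absolute weights are flip invariant, so the two exponentials of the upper
      bound contribute equally.\<close>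
    have swap_abs: "(\<Sum>x\<in>spins n. \<bar>r k x\<bar> * w x * exp (\<theta> * f (flip k x)))
        = (\<Sum>x\<in>spins n. \<bar>r k x\<bar> * w x * exp (\<theta> * f x))"
      unfolding reindex[of "\<lambda>x. \<bar>r k x\<bar> * w x * exp (\<theta> * f x)", symmetric]
      by (simp add: abs_anti)
    have "2 * \<bar>\<Sum>x\<in>spins n. r k x * w x * exp (\<theta> * f x)\<bar>
        = \<bar>\<Sum>x\<in>spins n. r k x * w x * (exp (\<theta> * f x) - exp (\<theta> * f (flip k x)))\<bar>"
      using swap by (simp add: algebra_simps sum_subtractf)
    also have "\<dots> \<le> (\<Sum>x\<in>spins n. \<bar>r k x * w x * (exp (\<theta> * f x) - exp (\<theta> * f (flip k x)))\<bar>)"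
      by (rule sum_abs)
    also have "\<dots> \<le> (\<Sum>x\<in>spins n. \<bar>r k x\<bar> * w x *
        (2 * K * \<bar>\<theta>\<bar> * (exp (\<theta> * f x) + exp (\<theta> * f (flip k x)))))"
    proof (rule sum_mono)
      fix x assume x: "x \<in> spins n"
      have "\<bar>exp (\<theta> * f x) - exp (\<theta> * f (flip k x))\<bar>
          \<le> \<bar>\<theta> * f x - \<theta> * f (flip k x)\<bar> * (exp (\<theta> * f x) + exp (\<theta> * f (flip k x)))"
        by (rule abs_exp_diff_le)
      also have "\<bar>\<theta> * f x - \<theta> * f (flip k x)\<bar> \<le> \<bar>\<theta>\<bar> * (2 * K)"
        using residual_sum_flip_diff[OF Q k x S, of \<beta> \<mu>]
        by (auto simp: f_def K_def abs_mult right_diff_distrib [symmetric] intro!: mult_left_mono)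
      finally have "\<bar>exp (\<theta> * f x) - exp (\<theta> * f (flip k x))\<bar>
          \<le> 2 * K * \<bar>\<theta>\<bar> * (exp (\<theta> * f x) + exp (\<theta> * f (flip k x)))"
        by (simp add: mult.assoc mult.commute mult.left_commute mult_right_mono)
      then show "\<bar>r k x * w x * (exp (\<theta> * f x) - exp (\<theta> * f (flip k x)))\<bar> \<le> \<bar>r k x\<bar> * w x *
        (2 * K * \<bar>\<theta>\<bar> * (exp (\<theta> * f x) + exp (\<theta> * f (flip k x))))"
        using wpos[of x] by (auto simp: abs_mult intro!: mult_left_mono)
    qed
    also have "\<dots> = 2 * K * \<bar>\<theta>\<bar> * ((\<Sum>x\<in>spins n. \<bar>r k x\<bar> * w x * exp (\<theta> * f x))
        + (\<Sum>x\<in>spins n. \<bar>r k x\<bar> * w x * exp (\<theta> * f (flip k x))))"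
      by (simp add: sum_distrib_left sum.distrib [symmetric] algebra_simps)
    also have "\<dots> = 4 * K * \<bar>\<theta>\<bar> * (\<Sum>x\<in>spins n. \<bar>r k x\<bar> * w x * exp (\<theta> * f x))"
      by (simp add: swap_abs)
    \<comment> \<open>The bound 2 on the residual matches the factor 2 on the left of the
      chain.\<close>
    also have "\<dots> \<le> 4 * K * \<bar>\<theta>\<bar> * (\<Sum>x\<in>spins n. 2 * w x * exp (\<theta> * f x))"
      using K wpos abs_spin_residual_le[OF _ k]
      by (intro mult_left_mono sum_mono mult_right_mono) (auto simp: r_def less_imp_le)
    also have "\<dots> = 2 * (4 * K * \<bar>\<theta>\<bar> * M)"
      by (simp add: M_def sum_distrib_left algebra_simps)
    finally show ?thesis by (simp add: mult_ac)
  qed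
  have "(\<Sum>x\<in>spins n. w x * (f x * exp (\<theta> * f x)))
      = (\<Sum>x\<in>spins n. \<Sum>k\<in>S. r k x * w x * exp (\<theta> * f x))"
    unfolding f_def r_def
    by (intro sum.cong refl) (simp only: sum_distrib_left sum_distrib_right mult_ac)
  also have "\<dots> = (\<Sum>k\<in>S. \<Sum>x\<in>spins n. r k x * w x * exp (\<theta> * f x))"
    by (rule sum.swap)
  finally have "\<bar>\<Sum>x\<in>spins n. w x * (f x * exp (\<theta> * f x))\<bar>
      \<le> (\<Sum>k\<in>S. \<bar>\<Sum>x\<in>spins n. r k x * w x * exp (\<theta> * f x)\<bar>)"
    by (simp add: sum_abs)
  also have "\<dots> \<le> (\<Sum>k\<in>S. 4 * K * \<bar>\<theta>\<bar> * M)"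
    by (intro sum_mono single)
  finally show ?thesis by (simp add: M_def mult_ac)
qed

text \<open>A Gronwall argument: the derivative bound makes \<open>M t * exp (- c * t^2)\<close>
  nonincreasing for nonnegative \<open>t\<close>, and \<open>M 0\<close> is the partition function.
  The sign \<open>\<sigma>\<close> covers both tails.\<close>

lemma residual_sum_mgf_le:
  fixes \<theta> \<sigma> \<beta> :: real and \<mu> :: "nat \<Rightarrow> real"
  assumes Q: "coupling_matrix n Q" and S: "S \<subseteq> {1..n}" and \<sigma>: "\<bar>\<sigma>\<bar> = 1" and \<theta>: "0 \<le> \<theta>"
  defines "f \<equiv> \<lambda>x. \<Sum>i\<in>S. spin_residual n \<beta> Q \<mu> i x"
    and "w \<equiv> ising_weight n \<beta> Q \<mu>"
    and "K \<equiv> 1 + \<bar>\<beta>\<bar> * norm_inf_inf n Q"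
  shows "(\<Sum>x\<in>spins n. w x * exp (\<theta> * (\<sigma> * f x)))
       \<le> ising_Z n \<beta> Q \<mu> * exp (2 * K * real (card S) * \<theta>^2)"
proof -
  \<comment> \<open>Half of the constant \<open>4 * K * card S\<close> in the derivative bound,
    since \<open>c * t^2\<close> has derivative \<open>2 * c * t\<close>.\<close>
  define c where "c = 2 * K * real (card S)"
  define M where "M t = (\<Sum>x\<in>spins n. w x * exp (t * (\<sigma> * f x)))" for t
  define M' where "M' t = (\<Sum>x\<in>spins n. w x * (\<sigma> * f x * exp (t * (\<sigma> * f x))))" for t
  have der: "(M has_real_derivative M' t) (at t)" for t
    unfolding M_def M'_def by (auto intro!: derivative_eq_intros simp: mult_ac)
  have bound: "M' t \<le> 2 * c * t * M t" if "0 \<le> t" for t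
  proof -
    have "M' t = \<sigma> * (\<Sum>x\<in>spins n. w x * (f x * exp ((t * \<sigma>) * f x)))"
      by (simp add: M'_def sum_distrib_left mult_ac)
    also have "\<dots> \<le> \<bar>\<Sum>x\<in>spins n. w x * (f x * exp ((t * \<sigma>) * f x))\<bar>"
      by (rule order_trans[OF abs_ge_self]) (simp add: abs_mult \<sigma>)
    also have "\<dots> \<le> 4 * K * real (card S) * \<bar>t * \<sigma>\<bar> * (\<Sum>x\<in>spins n. w x * exp ((t * \<sigma>) * f x))"
      unfolding f_def w_def K_def by (rule residual_sum_mgf_deriv_le[OF Q S])
    also have "\<dots> = 2 * c * t * M t"
      using \<sigma> that by (simp add: abs_mult M_def c_def mult_ac)
    finally show ?thesis .
  qed
  have "M \<theta> * exp (- c * \<theta>^2) \<le> M 0 * exp (- c * 0^2)"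
  proof (rule DERIV_nonpos_imp_nonincreasing[OF \<theta>])
    fix t :: real assume t: "0 \<le> t"
    have "((\<lambda>t. M t * exp (- c * t^2)) has_real_derivative
        (M' t - 2 * c * t * M t) * exp (- c * t^2)) (at t)"
      by (auto intro!: derivative_eq_intros der simp: algebra_simps)
    moreover have "(M' t - 2 * c * t * M t) * exp (- c * t^2) \<le> 0"
      using bound[OF t] by (simp add: mult_nonpos_nonneg)
    ultimately show "\<exists>y. ((\<lambda>t. M t * exp (- c * t^2)) has_real_derivative y) (at t) \<and> y \<le> 0"
      by blast
  qed
  then have "M \<theta> \<le> M 0 * exp (c * \<theta>^2)"
    by (simp add: exp_minus field_simps)
  then show ?thesis by (simp add: M_def c_def w_def ising_Z_def)
qed

section \<open>Probabilities and tail bounds under the Ising law\<close>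

lemma prob_ising:
  "measure_pmf.prob (ising_pmf n \<beta> Q \<mu>) B
     = (\<Sum>x\<in>spins n \<inter> B. ising_weight n \<beta> Q \<mu> x) / ising_Z n \<beta> Q \<mu>"
proof -
  have "set_pmf (ising_pmf n \<beta> Q \<mu>) \<subseteq> spins n"
    by (auto simp: set_pmf_iff pmf_ising split: if_splits)
  then have "measure_pmf.prob (ising_pmf n \<beta> Q \<mu>) B
      = measure_pmf.prob (ising_pmf n \<beta> Q \<mu>) (spins n \<inter> B)"
    by (intro measure_prob_cong_0) (auto simp: pmf_ising)
  also have "\<dots> = (\<Sum>x\<in>spins n \<inter> B. pmf (ising_pmf n \<beta> Q \<mu>) x)"
    by (rule measure_measure_pmf_finite) simp
  also have "\<dots> = (\<Sum>x\<in>spins n \<inter> B. ising_weight n \<beta> Q \<mu> x / ising_Z n \<beta> Q \<mu>)"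
    by (intro sum.cong) (auto simp: pmf_ising)
  finally show ?thesis by (simp add: sum_divide_distrib)
qed

text \<open>Inclusion is asked on \<open>spins n\<close>, where the law lives: the bound on the
  local fields that compares acceptance with a tail event holds for spins of modulus 1.\<close>

lemma prob_ising_mono:
  assumes "\<And>x. x \<in> spins n \<Longrightarrow> x \<in> B \<Longrightarrow> x \<in> B'"
  shows "measure_pmf.prob (ising_pmf n \<beta> Q \<mu>) B \<le> measure_pmf.prob (ising_pmf n \<beta> Q \<mu>) B'"
  unfolding prob_ising using assms
  by (intro divide_right_mono sum_mono2) (auto intro: less_imp_le ising_weight_pos ising_Z_pos)

text \<open>Chernoff's bound from the moment generating function.\<close>

lemma residual_sum_tail:
  fixes t \<sigma> :: real
  assumes Q: "coupling_matrix n Q" and S: "S \<subseteq> {1..n}" "S \<noteq> {}" and \<sigma>: "\<bar>\<sigma>\<bar> = 1" and t: "0 \<le> t"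
  shows "measure_pmf.prob (ising_pmf n \<beta> Q \<mu>)
           {x. t \<le> \<sigma> * (\<Sum>i\<in>S. spin_residual n \<beta> Q \<mu> i x)}
       \<le> exp (- (t^2 / (8 * (1 + \<bar>\<beta>\<bar> * norm_inf_inf n Q) * real (card S))))"
proof -
  define f where "f x = \<sigma> * (\<Sum>i\<in>S. spin_residual n \<beta> Q \<mu> i x)" for x
  define K where "K = 1 + \<bar>\<beta>\<bar> * norm_inf_inf n Q"
  define c where "c = 2 * K * real (card S)"
  \<comment> \<open>The minimizer of \<open>c * \<theta>^2 - \<theta> * t\<close>, with minimum
    \<open>- t^2 / (4 * c)\<close>.\<close>
  define \<theta> where "\<theta> = t / (2 * c)"
  have "1 \<le> n" using S by auto
  then have "1 \<le> K" using norm_inf_inf_nonneg[of n Q] by (simp add: K_def)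
  moreover have "0 < card S" using S finite_subset[OF S(1)] by (simp add: card_gt_0_iff)
  ultimately have c: "0 < c" by (simp add: c_def)
  have \<theta>: "0 \<le> \<theta>" using t c by (simp add: \<theta>_def)
  let ?w = "ising_weight n \<beta> Q \<mu>" and ?Z = "ising_Z n \<beta> Q \<mu>"
  have "(\<Sum>x\<in>spins n \<inter> {x. t \<le> f x}. ?w x) \<le> (\<Sum>x\<in>spins n \<inter> {x. t \<le> f x}. ?w x * exp (\<theta> * (f x - t)))"
  proof (rule sum_mono)
    fix x assume "x \<in> spins n \<inter> {x. t \<le> f x}"
    then have "1 \<le> exp (\<theta> * (f x - t))" using \<theta> by simp
    then show "?w x \<le> ?w x * exp (\<theta> * (f x - t))"
      using ising_weight_pos[of n \<beta> Q \<mu> x] by simp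
  qed
  also have "\<dots> \<le> (\<Sum>x\<in>spins n. ?w x * exp (\<theta> * (f x - t)))"
    by (intro sum_mono2) (auto intro!: mult_nonneg_nonneg intro: less_imp_le[OF ising_weight_pos])
  also have "\<dots> = (\<Sum>x\<in>spins n. ?w x * exp (\<theta> * f x)) * exp (- \<theta> * t)"
    by (simp add: sum_distrib_right right_diff_distrib exp_diff exp_minus divide_inverse mult.assoc)
  also have "\<dots> \<le> ?Z * exp (c * \<theta>^2) * exp (- \<theta> * t)"
    unfolding f_def c_def K_def
    by (intro mult_right_mono residual_sum_mgf_le[OF Q S(1) \<sigma> \<theta>]) simp
  also have "\<dots> = ?Z * exp (- (t^2 / (4 * c)))"
    using c by (simp add: \<theta>_def mult.assoc field_simps power2_eq_square flip: exp_add)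
  finally have "measure_pmf.prob (ising_pmf n \<beta> Q \<mu>) {x. t \<le> f x} \<le> exp (- (t^2 / (4 * c)))"
    unfolding prob_ising using ising_Z_pos[of n \<beta> Q \<mu>] by (simp add: field_simps)
  moreover have "4 * c = 8 * K * real (card S)" by (simp add: c_def)
  ultimately show ?thesis by (simp only: f_def K_def)
qed

section \<open>The two error probabilities of the scan test\<close>

text \<open>A union bound over the sets of the class and the two signs: each of the
  \<open>2 * N\<close> tail events has probability at most
  \<open>N powr (- (1 + \<delta>))\<close>.\<close>

lemma scan_test_null_prob:
  fixes \<beta> \<delta> :: real
  assumes Q: "coupling_matrix n Q" and n: "1 \<le> n" and s: "1 \<le> s"
    and C: "\<And>S. S \<in> \<C> \<Longrightarrow> S \<subseteq> {1..n} \<and> card S = s" "\<C> \<noteq> {}" and \<delta>: "0 < \<delta>"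
  shows "measure_pmf.prob (ising_pmf n \<beta> Q (\<lambda>_. 0)) {x. scan_test n \<beta> Q \<C> \<delta> x}
       \<le> 2 * real (card \<C>) powr (- \<delta>)"
proof -
  define K where "K = 1 + \<bar>\<beta>\<bar> * norm_inf_inf n Q"
  define N where "N = real (card \<C>)"
  define b where "b = 2 * K * sqrt (2 * (1 + \<delta>) * ln N)"
  define t where "t = b * sqrt (real s)"
  define f where "f S x = (\<Sum>i\<in>S. spin_residual n \<beta> Q (\<lambda>_. 0) i x)" for S x
  let ?P = "measure_pmf.prob (ising_pmf n \<beta> Q (\<lambda>_. 0))"
  have K: "1 \<le> K" using norm_inf_inf_nonneg[OF n, of Q] by (simp add: K_def)
  have fin: "finite \<C>" by (rule finite_subset[of _ "Pow {1..n}"]) (use C in auto)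
  have N: "1 \<le> N" using fin C(2) by (simp add: N_def Suc_le_eq card_gt_0_iff)
  have lnN: "0 \<le> ln N" using N by simp
  have t: "0 \<le> t" using K lnN \<delta> by (simp add: t_def b_def)
  \<comment> \<open>The threshold contributes \<open>K^2\<close>, the variance proxy only
    \<open>K\<close>; the surplus factor \<open>K \<ge> 1\<close> is discarded later.\<close>
  have t2: "t^2 / (8 * K * real s) = K * (1 + \<delta>) * ln N"
  proof -
    have "t^2 = 8 * K^2 * ((1 + \<delta>) * ln N) * real s"
      using lnN \<delta> by (simp add: t_def b_def power_mult_distrib)
    then show ?thesis using K s by (simp add: power2_eq_square)
  qed
  have "{x. scan_test n \<beta> Q \<C> \<delta> x} \<subseteq> (\<Union>(S, \<sigma>)\<in>\<C> \<times> {1, -1}. {x. t \<le> \<sigma> * f S x})"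
  proof
    fix x assume "x \<in> {x. scan_test n \<beta> Q \<C> \<delta> x}"
    then have "b < (SUP S\<in>\<C>. \<bar>1 / sqrt (real (card S)) * f S x\<bar>)"
      by (simp add: scan_test_def scan_stat_def b_def K_def N_def f_def spin_residual_def)
    then obtain S where S: "S \<in> \<C>" "b < \<bar>1 / sqrt (real (card S)) * f S x\<bar>"
      using fin C(2) by (subst (asm) less_cSUP_iff) auto
    then have "b < \<bar>f S x\<bar> / sqrt (real s)" using C(1)[OF S(1)] by (simp add: abs_mult)
    then have "t \<le> \<bar>f S x\<bar>" using s by (simp add: t_def field_simps)
    then have "t \<le> 1 * f S x \<or> t \<le> - 1 * f S x" by auto
    then show "x \<in> (\<Union>(S, \<sigma>)\<in>\<C> \<times> {1, -1}. {x. t \<le> \<sigma> * f S x})" using S(1) by auto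
  qed
  then have "?P {x. scan_test n \<beta> Q \<C> \<delta> x} \<le> ?P (\<Union>(S, \<sigma>)\<in>\<C> \<times> {1, -1}. {x. t \<le> \<sigma> * f S x})"
    by (intro measure_pmf.finite_measure_mono) auto
  also have "\<dots> \<le> (\<Sum>p\<in>\<C> \<times> {1, -1}. ?P (case p of (S, \<sigma>) \<Rightarrow> {x. t \<le> \<sigma> * f S x}))"
    using fin by (intro measure_pmf.finite_measure_subadditive_finite) auto
  also have "\<dots> \<le> (\<Sum>p\<in>\<C> \<times> {1, - 1 :: real}. exp (- (K * (1 + \<delta>) * ln N)))"
  proof (rule sum_mono)
    fix p :: "nat set \<times> real" assume "p \<in> \<C> \<times> {1, -1}"
    then obtain S \<sigma> where p: "p = (S, \<sigma>)" "S \<in> \<C>" "\<bar>\<sigma>\<bar> = 1" by auto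
    have "S \<noteq> {}" using C(1)[OF p(2)] s by auto
    then show "?P (case p of (S, \<sigma>) \<Rightarrow> {x. t \<le> \<sigma> * f S x}) \<le> exp (- (K * (1 + \<delta>) * ln N))"
      using residual_sum_tail[OF Q _ _ p(3) t, of S \<beta> "\<lambda>_. 0"] C(1)[OF p(2)] p(1)
      by (simp add: f_def K_def[symmetric] t2)
  qed
  also have "\<dots> = 2 * N * exp (- (K * (1 + \<delta>) * ln N))"
    by (simp add: N_def card_cartesian_product)
  also have "\<dots> \<le> 2 * N * exp (- ((1 + \<delta>) * ln N))"
    using K lnN \<delta> N mult_right_mono[of 1 K "(1 + \<delta>) * ln N"] by (auto simp: mult.assoc)
  also have "\<dots> = 2 * N powr (- \<delta>)"
    using N by (simp add: powr_def exp_minus exp_diff distrib_right divide_inverse)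
  finally show ?thesis by (simp add: N_def)
qed

text \<open>Acceptance bounds the scan sum over the true support \<open>S\<close> from above.
  Subtracting the drift caused by \<open>\<mu>\<close> forces the residual sum at field
  \<open>\<mu>\<close> below \<open>- t\<close>, a rare event.\<close>

lemma scan_test_alternative_prob:
  fixes \<beta> \<delta> C\<^sub>u C\<^sub>u' :: real
  defines "K \<equiv> 1 + \<bar>\<beta>\<bar> * C\<^sub>u'"
    and "c \<equiv> (1 - tanh (\<bar>\<beta>\<bar> * C\<^sub>u') ^ 2) / 2"
  assumes Q: "coupling_matrix n Q" and norm: "norm_inf_inf n Q \<le> C\<^sub>u'" and n: "1 \<le> n"
    and s: "1 \<le> s" and C: "\<And>S. S \<in> \<C> \<Longrightarrow> S \<subseteq> {1..n} \<and> card S = s"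
    and \<delta>: "0 < \<delta>" "\<delta> < 1" and A: "0 < A"
    and card: "ln (real (card \<C>)) \<le> C\<^sub>u * ln (real n)" and Cu: "0 \<le> C\<^sub>u"
    and signal: "(4 * K * sqrt C\<^sub>u + 1) / c * sqrt (ln (real n) / real s) \<le> tanh A"
    and \<mu>: "\<mu> \<in> alternatives n \<C> A"
  shows "measure_pmf.prob (ising_pmf n \<beta> Q \<mu>) {x. \<not> scan_test n \<beta> Q \<C> \<delta> x}
       \<le> real n powr (- 1 / (8 * K))"
proof -
  define S where "S = supp n \<mu>"
  define k where "k = 1 + \<bar>\<beta>\<bar> * norm_inf_inf n Q"
  define N where "N = real (card \<C>)"
  define b where "b = 2 * k * sqrt (2 * (1 + \<delta>) * ln N)"
  \<comment> \<open>The room left by the summand 1 in \<open>4 * K * sqrt C\<^sub>u + 1\<close>; the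
    other summand absorbs the threshold.\<close>
  define t where "t = sqrt (real s) * sqrt (ln (real n))"
  have S: "S \<in> \<C>" "\<And>i. i \<in> S \<Longrightarrow> A \<le> \<mu> i" using \<mu> by (auto simp: alternatives_def S_def)
  then have Sn: "S \<subseteq> {1..n}" "card S = s" using C by auto
  have S_ne: "S \<noteq> {}" using Sn s by auto
  have fin: "finite \<C>" by (rule finite_subset[of _ "Pow {1..n}"]) (use C in auto)
  have "1 \<le> N" using fin S(1) by (auto simp: N_def Suc_le_eq card_gt_0_iff)
  then have lnN: "0 \<le> ln N" by simp
  have lnn: "0 \<le> ln (real n)" using n by simp
  have k: "1 \<le> k" "k \<le> K" using norm_inf_inf_nonneg[OF n, of Q] norm
    by (auto simp: k_def K_def mult_left_mono)
  have "tanh (\<bar>\<beta>\<bar> * C\<^sub>u') ^ 2 < 1"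
    using tanh_real_lt_1[of "\<bar>\<beta>\<bar> * C\<^sub>u'"] tanh_real_gt_neg1[of "\<bar>\<beta>\<bar> * C\<^sub>u'"]
    by (simp add: abs_square_less_1)
  then have c: "0 < c" by (simp add: c_def)
  \<comment> \<open>Here \<open>\<delta> < 1\<close> gives
    \<open>2 * (1 + \<delta>) \<le> 4\<close>, the source of the 4 in the signal constant.\<close>
  have "2 * (1 + \<delta>) * ln N \<le> 4 * (C\<^sub>u * ln (real n))"
    using card lnN \<delta> by (intro mult_mono) (auto simp: N_def)
  then have "sqrt (2 * (1 + \<delta>) * ln N) \<le> sqrt (4 * (C\<^sub>u * ln (real n)))" by simp
  also have "\<dots> = 2 * sqrt C\<^sub>u * sqrt (ln (real n))" by (simp add: real_sqrt_mult)
  finally have b: "b \<le> 4 * K * sqrt C\<^sub>u * sqrt (ln (real n))"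
    using k lnN \<delta> mult_mono[of "2 * k" "2 * K" "sqrt (2 * (1 + \<delta>) * ln N)"
      "2 * sqrt C\<^sub>u * sqrt (ln (real n))"] by (simp add: b_def)
  have miss: "t \<le> - 1 * (\<Sum>i\<in>S. spin_residual n \<beta> Q \<mu> i x)"
    if x: "x \<in> spins n" and acc: "\<not> scan_test n \<beta> Q \<C> \<delta> x" for x
  proof -
    define h where "h i = \<beta> * local_field n Q x i" for i
    define f0 where "f0 = (\<Sum>i\<in>S. x i - tanh (h i))"
    have "\<bar>1 / sqrt (real (card S)) * f0\<bar> \<le> scan_stat n \<beta> Q \<C> x"
      unfolding scan_stat_def f0_def h_def using S(1) fin by (intro cSUP_upper) auto
    also have "\<dots> \<le> b" using acc by (simp add: scan_test_def b_def k_def N_def)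
    finally have "\<bar>f0\<bar> / sqrt (real s) \<le> b" by (simp add: Sn abs_mult)
    then have f0: "f0 \<le> sqrt (real s) * b" using s by (simp add: field_simps)
    \<comment> \<open>The constant \<open>c\<close> is uniform in \<open>x\<close> because each
      \<open>h i\<close> is at most \<open>\<bar>\<beta>\<bar> * C\<^sub>u'\<close> in
      modulus.\<close>
    have drift: "c * tanh A \<le> tanh (h i + \<mu> i) - tanh (h i)" if "i \<in> S" for i
      unfolding c_def
    proof (rule tanh_add_diff_ge)
      have "\<bar>local_field n Q x i\<bar> \<le> C\<^sub>u'"
        using abs_local_field_le[OF x, of i Q] Sn(1) that norm by auto
      then show "\<bar>h i\<bar> \<le> \<bar>\<beta>\<bar> * C\<^sub>u'" by (simp add: h_def abs_mult mult_left_mono)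
    qed (use A S(2)[OF that] in auto)
    have "(\<Sum>i\<in>S. spin_residual n \<beta> Q \<mu> i x)
        = f0 - (\<Sum>i\<in>S. tanh (h i + \<mu> i) - tanh (h i))"
      by (simp add: f0_def h_def spin_residual_def sum_subtractf)
    moreover have "real s * (c * tanh A) \<le> (\<Sum>i\<in>S. tanh (h i + \<mu> i) - tanh (h i))"
      using sum_mono[of S "\<lambda>_. c * tanh A", OF drift] Sn by simp
    moreover have "(4 * K * sqrt C\<^sub>u + 1) * sqrt (ln (real n) / real s) \<le> c * tanh A"
      using signal c by (simp add: field_simps)
    then have "real s * ((4 * K * sqrt C\<^sub>u + 1) * sqrt (ln (real n) / real s)) \<le> real s * (c * tanh A)"
      by (intro mult_left_mono) auto
    moreover have "real s * ((4 * K * sqrt C\<^sub>u + 1) * sqrt (ln (real n) / real s))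
        = (4 * K * sqrt C\<^sub>u + 1) * t"
    proof -
      have "real s * sqrt (ln (real n) / real s)
          = (sqrt (real s) * sqrt (real s)) * (sqrt (ln (real n)) / sqrt (real s))"
        by (simp add: real_sqrt_divide)
      also have "\<dots> = t" using s by (simp add: t_def del: real_sqrt_mult_self)
      finally show ?thesis by (simp add: mult.left_commute)
    qed
    moreover have "sqrt (real s) * b \<le> 4 * K * sqrt C\<^sub>u * t"
      using mult_left_mono[OF b, of "sqrt (real s)"] by (simp add: t_def mult_ac)
    ultimately show ?thesis using f0 by (simp add: algebra_simps)
  qed
  have "measure_pmf.prob (ising_pmf n \<beta> Q \<mu>) {x. \<not> scan_test n \<beta> Q \<C> \<delta> x}
      \<le> measure_pmf.prob (ising_pmf n \<beta> Q \<mu>) {x. t \<le> - 1 * (\<Sum>i\<in>S. spin_residual n \<beta> Q \<mu> i x)}"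
    using miss by (intro prob_ising_mono) auto
  also have "\<dots> \<le> exp (- (t^2 / (8 * k * real s)))"
    unfolding k_def Sn(2)[symmetric] using lnn by (intro residual_sum_tail Q Sn S_ne) (auto simp: t_def)
  also have "t^2 / (8 * k * real s) = ln (real n) / (8 * k)"
    using s lnn by (simp add: t_def power_mult_distrib)
  \<comment> \<open>Passing from \<open>k\<close> to \<open>K\<close> makes the exponent independent
    of the coupling matrix.\<close>
  also have "exp (- (ln (real n) / (8 * k))) \<le> exp (- (ln (real n) / (8 * K)))"
    using k lnn by (auto intro!: divide_left_mono)
  also have "\<dots> = real n powr (- 1 / (8 * K))" using n by (simp add: powr_def)
  finally show ?thesis .
qed

section \<open>Vanishing of the risk\<close>

text \<open>Ensures that the real supremum in \<open>risk\<close> runs over a nonempty set. The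
  witness equals \<open>A\<close> on \<open>S\<close>, and \<open>A > 0\<close> makes its support
  exactly \<open>S\<close>; outside \<open>{1..n}\<close> it is \<open>undefined\<close>, as
  extensionality demands.\<close>

lemma alternatives_nonempty:
  assumes "0 < A" "S \<in> \<C>" "S \<subseteq> {1..n}"
  shows "alternatives n \<C> A \<noteq> {}"
proof -
  let ?\<mu> = "\<lambda>i. if i \<in> {1..n} then (if i \<in> S then A else 0) else undefined"
  have "supp n ?\<mu> = S" using assms by (auto simp: supp_def)
  then have "?\<mu> \<in> alternatives n \<C> A" using assms by (auto simp: alternatives_def)
  then show ?thesis by blast
qed

theorem theorem1:
  fixes \<beta> \<delta> C\<^sub>u C\<^sub>u' :: real
  assumes "0 < \<delta>" and "\<delta> < 1" and "0 < C\<^sub>u" and "0 < C\<^sub>u'"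
  shows "\<exists>C'>0. \<forall>\<upsilon>>0. \<forall>(Q :: nat \<Rightarrow> nat \<Rightarrow> nat \<Rightarrow> real) (s :: nat \<Rightarrow> nat)
           (A :: nat \<Rightarrow> real) (\<C> :: nat \<Rightarrow> nat set set).
      (\<forall>n\<ge>1. coupling_matrix n (Q n) \<and> norm_inf_inf n (Q n) \<le> C\<^sub>u') \<longrightarrow>
      (\<forall>n\<ge>1. s n \<in> {1..n} \<and> real (s n) \<le> real n powr (1 - \<upsilon>)) \<longrightarrow>
      (\<forall>n\<ge>1. 0 < A n) \<longrightarrow>
      (\<forall>n\<ge>1. \<forall>S\<in>\<C> n. S \<subseteq> {1..n} \<and> card S = s n) \<longrightarrow>
      filterlim (\<lambda>n. card (\<C> n)) at_top sequentially \<longrightarrow>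
      (\<forall>n\<ge>1. ln (real (card (\<C> n))) \<le> C\<^sub>u * ln (real n)) \<longrightarrow>
      (\<forall>\<^sub>F n in sequentially. tanh (A n) \<ge> C' * sqrt (ln (real n) / real (s n))) \<longrightarrow>
      asymptotically_powerful \<beta> Q \<C> A (\<lambda>n. scan_test n \<beta> (Q n) (\<C> n) \<delta>)"
proof -
  define K where "K = 1 + \<bar>\<beta>\<bar> * C\<^sub>u'"
  define c where "c = (1 - tanh (\<bar>\<beta>\<bar> * C\<^sub>u') ^ 2) / 2"
  have K: "1 \<le> K" using assms by (simp add: K_def)
  have "tanh (\<bar>\<beta>\<bar> * C\<^sub>u') ^ 2 < 1"
    using tanh_real_lt_1[of "\<bar>\<beta>\<bar> * C\<^sub>u'"] tanh_real_gt_neg1[of "\<bar>\<beta>\<bar> * C\<^sub>u'"]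
    by (simp add: abs_square_less_1)
  then have c: "0 < c" by (simp add: c_def)
  show ?thesis
  \<comment> \<open>The signal constant of \<open>scan_test_alternative_prob\<close>, fixed before
    the sequences are chosen.\<close>
  proof (intro exI[of _ "(4 * K * sqrt C\<^sub>u + 1) / c"] conjI allI impI)
    show "0 < (4 * K * sqrt C\<^sub>u + 1) / c" using K c assms by (simp add: add_nonneg_pos)
  next
    fix \<upsilon> :: real and Q :: "nat \<Rightarrow> nat \<Rightarrow> nat \<Rightarrow> real" and s :: "nat \<Rightarrow> nat"
      and A :: "nat \<Rightarrow> real" and \<C> :: "nat \<Rightarrow> nat set set"
    assume Q: "\<forall>n\<ge>1. coupling_matrix n (Q n) \<and> norm_inf_inf n (Q n) \<le> C\<^sub>u'"
      and s: "\<forall>n\<ge>1. s n \<in> {1..n} \<and> real (s n) \<le> real n powr (1 - \<upsilon>)"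
      and A: "\<forall>n\<ge>1. 0 < A n"
      and C: "\<forall>n\<ge>1. \<forall>S\<in>\<C> n. S \<subseteq> {1..n} \<and> card S = s n"
      and lim: "filterlim (\<lambda>n. card (\<C> n)) at_top sequentially"
      and card: "\<forall>n\<ge>1. ln (real (card (\<C> n))) \<le> C\<^sub>u * ln (real n)"
      and signal: "\<forall>\<^sub>F n in sequentially.
        (4 * K * sqrt C\<^sub>u + 1) / c * sqrt (ln (real n) / real (s n)) \<le> tanh (A n)"
    let ?T = "\<lambda>n. scan_test n \<beta> (Q n) (\<C> n) \<delta>"
    let ?R = "\<lambda>n. risk n \<beta> (Q n) (\<C> n) (A n) (?T n)"
    let ?B = "\<lambda>n. 2 * real (card (\<C> n)) powr (- \<delta>) + real n powr (- 1 / (8 * K))"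
    \<comment> \<open>The class is known to be nonempty only for large \<open>n\<close>, so the risk
      bounds hold eventually.\<close>
    have "\<forall>\<^sub>F n in sequentially. 1 \<le> card (\<C> n)"
      using lim by (simp add: filterlim_at_top)
    with signal eventually_ge_at_top[of 1]
    have ev: "\<forall>\<^sub>F n in sequentially. 0 \<le> ?R n \<and> ?R n \<le> ?B n"
    proof eventually_elim
      case (elim n)
      let ?P = "\<lambda>\<mu>. measure_pmf.prob (ising_pmf n \<beta> (Q n) \<mu>)"
      have ne: "\<C> n \<noteq> {}" using elim by auto
      then have alt_ne: "alternatives n (\<C> n) (A n) \<noteq> {}"
        using alternatives_nonempty[of "A n" _ "\<C> n" n] A C elim by blast
      have "?P (\<lambda>_. 0) {x. ?T n x} \<le> 2 * real (card (\<C> n)) powr (- \<delta>)"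
        using Q s C elim ne assms by (intro scan_test_null_prob[where s = "s n"]) auto
      moreover have alt: "?P \<mu> {x. \<not> ?T n x} \<le> real n powr (- 1 / (8 * K))"
        if "\<mu> \<in> alternatives n (\<C> n) (A n)" for \<mu>
        unfolding K_def
        by (rule scan_test_alternative_prob[where s = "s n" and C\<^sub>u = C\<^sub>u and A = "A n"])
          (use Q s A C card elim assms that in \<open>auto simp: K_def c_def\<close>)
      then have "(SUP \<mu>\<in>alternatives n (\<C> n) (A n). ?P \<mu> {x. \<not> ?T n x}) \<le> real n powr (- 1 / (8 * K))"
        by (intro cSUP_least alt_ne)
      moreover obtain \<mu> where "\<mu> \<in> alternatives n (\<C> n) (A n)" using alt_ne by blast
      \<comment> \<open>A real supremum is nonnegative once some member is and the set is bounded
        above; both are supplied here.\<close>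
      then have "0 \<le> (SUP \<mu>\<in>alternatives n (\<C> n) (A n). ?P \<mu> {x. \<not> ?T n x})"
        using alt by (intro cSUP_upper2[where x = \<mu>]) (auto intro: bdd_aboveI2)
      ultimately show ?case by (simp add: risk_def)
    qed
    \<comment> \<open>The null error vanishes as the class grows, the missed detections vanish as
      \<open>n\<close> grows.\<close>
    have "(\<lambda>n. real (card (\<C> n)) powr (- \<delta>)) \<longlonglongrightarrow> 0"
      using assms by (intro tendsto_neg_powr filterlim_compose[OF filterlim_real_sequentially lim]) auto
    moreover have "(\<lambda>n. real n powr (- 1 / (8 * K))) \<longlonglongrightarrow> 0"
      using K by (intro tendsto_neg_powr filterlim_real_sequentially) auto
    ultimately have "?B \<longlonglongrightarrow> 2 * 0 + 0"
      by (intro tendsto_intros)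
    then have "?R \<longlonglongrightarrow> 0"
      by (intro tendsto_sandwich[of "\<lambda>_. 0" ?R sequentially ?B])
        (use ev in \<open>auto elim: eventually_mono\<close>)
    then have "(\<lambda>n. ereal (?R n)) \<longlonglongrightarrow> 0"
      by (simp add: zero_ereal_def)
    then show "asymptotically_powerful \<beta> Q \<C> A ?T"
      unfolding asymptotically_powerful_def by (intro lim_imp_Limsup) auto
  qed
qed

end
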